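(* Let $P$ be a dcpo such that (1) the Scott space $\Sigma P$ is bounded-sober, and (2) every element of $P$ is the supremum of a directed set of quasicontinuous elements of $P$. Then $P$ is SCL-faithful.
   Context: A dcpo is a poset in which every (nonempty) directed subset has a supremum. A subset $A$ of a dcpo $P$ is Scott closed if it is a lower set and $\bigvee D\in A$ for every directed $D\subseteq A$; the Scott closed sets are the closed sets of the Scott topology $\sigma(P)$, and $\Sigma P=(P,\sigma(P))$. $C_\sigma(P)$ is the lattice of all Scott closed subsets of $P$ ordered by inclusion. A dcpo $P$ is SCL-faithful if for every dcpo $Q$, $C_\sigma(P)\cong C_\sigma(Q)$ (as lattices) implies $P\cong Q$ (as posets). A subset $A$ of a topological space is irreducible if whenever $A\subseteq F_1\cup F_2$ with $F_1,F_2$ closed, then $A\subseteq F_1$ or $A\subseteq F_2$. A $T_0$ space is bounded-sober if every nonempty irreducible closed subset that has an upper bound with respect to the specialization order ($x\le y$ iff $x\in cl(\{y\})$) is the closure of a point. A finite subset $F$ of a dcpo $R$ is way-below $a\in R$, written $F\ll a$, if for every directed $D\subseteq R$, $a\le\bigvee D$ implies $D\cap{\uparrow}F\neq\emptyset$, where ${\uparrow}F=\{x: y\le x\text{ for some }y\in F\}$. Let $fin(x)=\{F: F\text{ finite and }F\ll x\}$. A dcpo $R$ is quasicontinuous if for every $x\in R$ the family $fin(x)$ is directed (it is nonempty, and for all $F_1,F_2\in fin(x)$ there is $F\in fin(x)$ with $F\subseteq{\uparrow}F_1\cap{\uparrow}F_2$) and for every $y$ with $x\not\le y$ there is $F\in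 fin(x)$ with $y\notin{\uparrow}F$. An element $x$ of a dcpo $P$ is quasicontinuous if the sub-dcpo ${\downarrow}x=\{z\in P: z\le x\}$ is a quasicontinuous dcpo. *)

theory Defs
  imports "HOL-Analysis.Analysis" "HOL-Algebra.Complete_Lattice"
begin

text \<open>Algebra's \<^const>\<open>eq_closure_of\<close> would make \<open>X closure_of S\<close> ambiguous.\<close>

no_notation eq_closure_of (\<open>closure'_of\<index>\<close>)

definition directed :: "('a, 'm) gorder_scheme \<Rightarrow> 'a set \<Rightarrow> bool" where
  "directed P D \<longleftrightarrow> D \<subseteq> carrier P \<and> D \<noteq> {} \<and>
     (\<forall>x\<in>D. \<forall>y\<in>D. \<exists>z\<in>D. x \<sqsubseteq>\<^bsub>P\<^esub> z \<and> y \<sqsubseteq>\<^bsub>P\<^esub> z)"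

locale dcpo = partial_order P for P (structure) +
  assumes directed_has_lub: "directed P D \<Longrightarrow> \<exists>s. is_lub P s D"

definition up_set :: "('a, 'm) gorder_scheme \<Rightarrow> 'a set \<Rightarrow> 'a set" where
  "up_set P F = {x \<in> carrier P. \<exists>y\<in>F. y \<sqsubseteq>\<^bsub>P\<^esub> x}"

definition sub_down :: "('a, 'm) gorder_scheme \<Rightarrow> 'a \<Rightarrow> ('a, 'm) gorder_scheme" where
  "sub_down P x = P\<lparr>carrier := {z \<in> carrier P. z \<sqsubseteq>\<^bsub>P\<^esub> x}\<rparr>"

definition scott_closed :: "('a, 'm) gorder_scheme \<Rightarrow> 'a set \<Rightarrow> bool" where
  "scott_closed P A \<longleftrightarrow> A \<subseteq> carrier P \<and>
     (\<forall>y\<in>A. \<forall>x\<in>carrier P. x \<sqsubseteq>\<^bsub>P\<^esub> y \<longrightarrow> x \<in> A) \<and>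
     (\<forall>D. directed P D \<and> D \<subseteq> A \<longrightarrow> \<Squnion>\<^bsub>P\<^esub>D \<in> A)"

definition scott_space :: "('a, 'm) gorder_scheme \<Rightarrow> 'a topology" where
  "scott_space P = topology (\<lambda>U. U \<subseteq> carrier P \<and> scott_closed P (carrier P - U))"

definition C_sigma :: "('a, 'm) gorder_scheme \<Rightarrow> 'a set gorder" where
  "C_sigma P = \<lparr>carrier = {A. scott_closed P A}, eq = (=), le = (\<subseteq>)\<rparr>"

context dcpo
begin

lemma is_lub_sup: "directed P D \<Longrightarrow> is_lub P (\<Squnion>D) D"
  unfolding sup_def by (rule someI_ex) (rule directed_has_lub)

lemma sup_eqI: "is_lub P s D \<Longrightarrow> \<Squnion>D = s"
  unfolding sup_def by (rule some_equality, assumption) (metis weak_least_unique eq_is_equal)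

lemma scott_closed_empty: "scott_closed P {}"
  by (auto simp: scott_closed_def directed_def)

lemma sup_in_carrier: "directed P D \<Longrightarrow> \<Squnion>D \<in> carrier P"
  using is_lub_sup by (rule least_closed)

lemma scott_closed_carrier: "scott_closed P (carrier P)"
  using sup_in_carrier by (simp add: scott_closed_def)

lemma scott_closed_subset: "scott_closed P A \<Longrightarrow> A \<subseteq> carrier P"
  by (simp add: scott_closed_def)

lemma scott_closed_down: "scott_closed P A \<Longrightarrow> y \<in> A \<Longrightarrow> x \<in> carrier P \<Longrightarrow> x \<sqsubseteq> y \<Longrightarrow> x \<in> A"
  by (simp add: scott_closed_def)

lemma scott_closed_sup: "scott_closed P A \<Longrightarrow> directed P D \<Longrightarrow> D \<subseteq> A \<Longrightarrow> \<Squnion>D \<in> A"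
  by (simp add: scott_closed_def)

lemma scott_closedI:
  assumes "A \<subseteq> carrier P"
    and "\<And>x y. y \<in> A \<Longrightarrow> x \<in> carrier P \<Longrightarrow> x \<sqsubseteq> y \<Longrightarrow> x \<in> A"
    and "\<And>D. directed P D \<Longrightarrow> D \<subseteq> A \<Longrightarrow> \<Squnion>D \<in> A"
  shows "scott_closed P A"
  using assms by (simp add: scott_closed_def)

lemma scott_closed_Inter:
  assumes ne: "\<K> \<noteq> {}" and K: "\<And>A. A \<in> \<K> \<Longrightarrow> scott_closed P A"
  shows "scott_closed P (\<Inter>\<K>)"
proof (rule scott_closedI)
  obtain A where "A \<in> \<K>" using ne by blast
  then show "\<Inter>\<K> \<subseteq> carrier P"
    using scott_closed_subset[OF K] by blast
next
  fix x y assume y: "y \<in> \<Inter>\<K>" and x: "x \<in> carrier P" "x \<sqsubseteq> y"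
  show "x \<in> \<Inter>\<K>"
  proof
    fix A assume A: "A \<in> \<K>"
    show "x \<in> A" by (rule scott_closed_down[OF K[OF A] _ x]) (use y A in simp)
  qed
next
  fix D assume D: "directed P D" "D \<subseteq> \<Inter>\<K>"
  show "\<Squnion>D \<in> \<Inter>\<K>"
  proof
    fix A assume A: "A \<in> \<K>"
    show "\<Squnion>D \<in> A" by (rule scott_closed_sup[OF K[OF A] D(1)]) (use D A in auto)
  qed
qed

lemma scott_closed_Int:
  assumes "scott_closed P A" "scott_closed P B"
  shows "scott_closed P (A \<inter> B)"
proof -
  have "scott_closed P (\<Inter>{A, B})"
    by (rule scott_closed_Inter) (use assms in \<open>simp, elim insertE, simp_all\<close>)
  then show ?thesis by simp
qed

lemma scott_closed_Un:
  assumes A: "scott_closed P A" and B: "scott_closed P B"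
  shows "scott_closed P (A \<union> B)"
proof (rule scott_closedI)
  show "A \<union> B \<subseteq> carrier P"
    using scott_closed_subset A B by simp
next
  fix x y assume "y \<in> A \<union> B" "x \<in> carrier P" "x \<sqsubseteq> y"
  then show "x \<in> A \<union> B" using scott_closed_down[OF A] scott_closed_down[OF B] by (elim UnE) simp_all
next
  fix D assume D: "directed P D" and sub: "D \<subseteq> A \<union> B"
  have cofinal: "\<Squnion>D \<in> E"
    if E: "scott_closed P E" and cof: "\<And>x. x \<in> D \<Longrightarrow> \<exists>y\<in>D. x \<sqsubseteq> y \<and> y \<in> E" for E
  proof (rule scott_closed_sup[OF E D], rule subsetI)
    fix x assume x: "x \<in> D"
    then have "x \<in> carrier P" using D by (auto simp: directed_def)
    moreover obtain y where "x \<sqsubseteq> y" "y \<in> E" using cof[OF x] by blast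
    ultimately show "x \<in> E" using scott_closed_down[OF E] by simp
  qed
  show "\<Squnion>D \<in> A \<union> B"
  proof (rule ccontr)
    assume n: "\<Squnion>D \<notin> A \<union> B"
    then obtain x where x: "x \<in> D" "\<And>y. y \<in> D \<Longrightarrow> x \<sqsubseteq> y \<Longrightarrow> y \<notin> A"
      using cofinal[OF A] by (metis UnI1)
    from n obtain z where z: "z \<in> D" "\<And>y. y \<in> D \<Longrightarrow> z \<sqsubseteq> y \<Longrightarrow> y \<notin> B"
      using cofinal[OF B] by (metis UnI2)
    obtain w where "w \<in> D" "x \<sqsubseteq> w" "z \<sqsubseteq> w"
      using D x(1) z(1) by (metis directed_def)
    then show False using x(2)[of w] z(2)[of w] sub by auto
  qed
qed

lemma istopology_scott:
  "istopology (\<lambda>U. U \<subseteq> carrier P \<and> scott_closed P (carrier P - U))"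
  unfolding istopology_def
proof (intro conjI allI impI)
  fix S T
  assume S: "S \<subseteq> carrier P \<and> scott_closed P (carrier P - S)"
    and T: "T \<subseteq> carrier P \<and> scott_closed P (carrier P - T)"
  then show "S \<inter> T \<subseteq> carrier P" by blast
  show "scott_closed P (carrier P - S \<inter> T)"
    using S T scott_closed_Un by (simp add: Diff_Int)
next
  fix \<K> :: "'a set set"
  assume K: "\<forall>K\<in>\<K>. K \<subseteq> carrier P \<and> scott_closed P (carrier P - K)"
  then show "\<Union>\<K> \<subseteq> carrier P" by blast
  show "scott_closed P (carrier P - \<Union>\<K>)"
  proof (cases "\<K> = {}")
    case True
    then show ?thesis by (simp add: scott_closed_carrier)
  next
    case False
    then have "carrier P - \<Union>\<K> = \<Inter>((\<lambda>K. carrier P - K) ` \<K>)" by auto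
    then show ?thesis using False K scott_closed_Inter[of "(\<lambda>K. carrier P - K) ` \<K>"] by auto
  qed
qed

lemma openin_scott_space:
  "openin (scott_space P) U \<longleftrightarrow> U \<subseteq> carrier P \<and> scott_closed P (carrier P - U)"
  using istopology_scott by (simp add: scott_space_def)

lemma topspace_scott_space: "topspace (scott_space P) = carrier P"
proof
  show "topspace (scott_space P) \<subseteq> carrier P"
    using openin_scott_space[of "topspace (scott_space P)"] by simp
  have "openin (scott_space P) (carrier P)"
    by (simp add: openin_scott_space scott_closed_empty)
  then show "carrier P \<subseteq> topspace (scott_space P)" by (rule openin_subset)
qed

lemma closedin_scott_space: "closedin (scott_space P) A \<longleftrightarrow> scott_closed P A"
proof (cases "A \<subseteq> carrier P")
  case True
  then have "carrier P - (carrier P - A) = A" by blast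
  then show ?thesis
    using True by (simp add: closedin_def topspace_scott_space openin_scott_space)
next
  case False
  then show ?thesis
    by (simp add: closedin_def topspace_scott_space scott_closed_def)
qed

lemma lattice_C_sigma: "lattice (C_sigma P)"
proof -
  interpret C: partial_order "C_sigma P"
    by unfold_locales (simp_all add: C_sigma_def)
  show ?thesis
  proof unfold_locales
    fix A B assume AB: "A \<in> carrier (C_sigma P)" "B \<in> carrier (C_sigma P)"
    then have "scott_closed P (A \<union> B)" "scott_closed P (A \<inter> B)"
      using scott_closed_Un[of A B] scott_closed_Int[of A B] by (simp_all add: C_sigma_def)
    then have "is_lub (C_sigma P) (A \<union> B) {A, B}" "is_glb (C_sigma P) (A \<inter> B) {A, B}"
      using AB by (simp_all add: C_sigma_def least_def greatest_def Upper_def Lower_def)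
    then show "\<exists>s. is_lub (C_sigma P) s {A, B}" "\<exists>s. is_glb (C_sigma P) s {A, B}"
      by (simp_all only: exI)
  qed
qed

end

definition irreducible_in :: "'a topology \<Rightarrow> 'a set \<Rightarrow> bool" where
  "irreducible_in X A \<longleftrightarrow> A \<subseteq> topspace X \<and>
     (\<forall>F1 F2. closedin X F1 \<and> closedin X F2 \<and> A \<subseteq> F1 \<union> F2 \<longrightarrow> A \<subseteq> F1 \<or> A \<subseteq> F2)"

definition specialization_le :: "'a topology \<Rightarrow> 'a \<Rightarrow> 'a \<Rightarrow> bool" where
  "specialization_le X x y \<longleftrightarrow> x \<in> X closure_of {y}"

definition bounded_sober_space :: "'a topology \<Rightarrow> bool" where
  "bounded_sober_space X \<longleftrightarrow> t0_space X \<and>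
     (\<forall>A. A \<noteq> {} \<and> irreducible_in X A \<and> closedin X A \<and>
          (\<exists>u\<in>topspace X. \<forall>a\<in>A. specialization_le X a u) \<longrightarrow>
        (\<exists>x\<in>topspace X. A = X closure_of {x}))"

definition way_below :: "('a, 'm) gorder_scheme \<Rightarrow> 'a set \<Rightarrow> 'a \<Rightarrow> bool" where
  "way_below R F a \<longleftrightarrow>
     (\<forall>D. directed R D \<and> a \<sqsubseteq>\<^bsub>R\<^esub> \<Squnion>\<^bsub>R\<^esub>D \<longrightarrow> D \<inter> up_set R F \<noteq> {})"

definition fin_below :: "('a, 'm) gorder_scheme \<Rightarrow> 'a \<Rightarrow> 'a set set" where
  "fin_below R x = {F. finite F \<and> F \<subseteq> carrier R \<and> way_below R F x}"

definition quasicontinuous :: "('a, 'm) gorder_scheme \<Rightarrow> bool" where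
  "quasicontinuous R \<longleftrightarrow> dcpo R \<and>
     (\<forall>x\<in>carrier R.
        fin_below R x \<noteq> {} \<and>
        (\<forall>F1\<in>fin_below R x. \<forall>F2\<in>fin_below R x. \<exists>F\<in>fin_below R x.
            F \<subseteq> up_set R F1 \<inter> up_set R F2) \<and>
        (\<forall>y\<in>carrier R. \<not> x \<sqsubseteq>\<^bsub>R\<^esub> y \<longrightarrow> (\<exists>F\<in>fin_below R x. y \<notin> up_set R F)))"

definition quasicontinuous_element :: "('a, 'm) gorder_scheme \<Rightarrow> 'a \<Rightarrow> bool" where
  "quasicontinuous_element P x \<longleftrightarrow> x \<in> carrier P \<and> quasicontinuous (sub_down P x)"

definition order_isomorphic ::
  "('a, 'm) gorder_scheme \<Rightarrow> ('b, 'n) gorder_scheme \<Rightarrow> bool" where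
  "order_isomorphic P Q \<longleftrightarrow>
     (\<exists>f. bij_betw f (carrier P) (carrier Q) \<and> order_emb P Q f)"

definition lattice_isomorphic ::
  "('a, 'm) gorder_scheme \<Rightarrow> ('b, 'n) gorder_scheme \<Rightarrow> bool" where
  "lattice_isomorphic L M \<longleftrightarrow>
     (\<exists>f. bij_betw f (carrier L) (carrier M) \<and> join_pres L M f \<and> meet_pres L M f)"

text \<open>HOL cannot quantify over types inside a formula, so the type of the competing dcpos is a
  parameter. A theorem with conclusion \<open>SCL_faithful TYPE('b) P\<close> for a type variable \<open>'b\<close>
  covers dcpos over arbitrary types.\<close>

definition SCL_faithful :: "'b itself \<Rightarrow> ('a, 'm) gorder_scheme \<Rightarrow> bool" where
  "SCL_faithful T P \<longleftrightarrow> dcpo P \<and>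
     (\<forall>Q :: 'b gorder. dcpo Q \<longrightarrow>
        lattice_isomorphic (C_sigma P) (C_sigma Q) \<longrightarrow> order_isomorphic P Q)"

end

theory Submission
  imports Defs
begin

text \<open>
  An isomorphism \<open>\<phi>\<close> from the Scott closed sets of \<open>P\<close> to those of \<open>Q\<close> induces an order
  isomorphism as soon as it matches principal ideals with principal ideals. The difficulty is
  that being principal is not visible in the closed set lattice: principal ideals are irreducible
  closed sets, but in a dcpo whose Scott topology is not sober there are others.

  For a quasicontinuous element \<open>x\<close> there is a lattice property that does force principality. The
  open sets of a quasicontinuous dcpo form a hypercontinuous lattice; this is read off from the
  interpolation property of the relation \<open>\<lless>\<close>. Hypercontinuity of \<open>\<down>x\<close> passes through \<open>\<phi>\<close> to the
  closed set \<open>\<phi> (\<down>x)\<close>, and there it says that every point has small neighbourhoods that are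
  generated, as upper sets, by finitely many points. An irreducible closed set with this property
  has a greatest element (\<open>hypercontinuous_irreducible_eq_down\<close>), so \<open>\<phi> (\<down>x) = \<down>y\<close> for some \<open>y\<close>.
  Interpolation and this last step both rest on Rudin's lemma: a filtered family of finite sets
  can be met by a single directed set.

  Since \<open>\<phi>\<close> preserves joins, the same then holds for directed suprema of quasicontinuous elements,
  that is, for every \<open>x\<close> in \<open>P\<close>. This gives an order embedding \<open>f\<close> of \<open>P\<close> into \<open>Q\<close> that preserves
  directed suprema. Bounded sobriety of \<open>P\<close> is what makes \<open>f\<close> surjective: an element \<open>y\<close> of \<open>Q\<close>
  below some \<open>f x\<close> corresponds to an irreducible closed subset of \<open>P\<close> bounded by \<open>x\<close>, which is
  therefore principal, and so \<open>y\<close> is a value of \<open>f\<close>. Hence the range of \<open>f\<close> is Scott closed. But the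
  smallest Scott closed set containing the range is \<open>\<phi>\<close> of the smallest one containing all
  elements of \<open>P\<close>, which is \<open>Q\<close>
  (\<open>order_isomorphic_if_images_principal\<close>).
\<close>

section \<open>Principal ideals\<close>

definition down :: "('a, 'm) gorder_scheme \<Rightarrow> 'a \<Rightarrow> 'a set" where
  "down P x = {z \<in> carrier P. z \<sqsubseteq>\<^bsub>P\<^esub> x}"

context dcpo
begin

lemma directed_sup_upper: "directed P D \<Longrightarrow> d \<in> D \<Longrightarrow> d \<sqsubseteq> \<Squnion>D"
  using least_Upper_above[OF is_lub_sup] by (auto simp: directed_def)

lemma directed_sup_least:
  assumes "directed P D" "u \<in> carrier P" "\<And>d. d \<in> D \<Longrightarrow> d \<sqsubseteq> u"
  shows "\<Squnion>D \<sqsubseteq> u"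
  using least_le[OF is_lub_sup[OF assms(1)], of u] assms(2,3) by (auto simp: Upper_def)

lemma directed_singleton: "x \<in> carrier P \<Longrightarrow> directed P {x}"
  by (auto simp: directed_def)

lemma sup_singleton: "x \<in> carrier P \<Longrightarrow> \<Squnion>{x} = x"
  using directed_singleton[of x] directed_sup_upper[of "{x}" x] directed_sup_least[of "{x}" x]
    sup_in_carrier[of "{x}"] le_antisym by auto

lemma in_down_self: "x \<in> carrier P \<Longrightarrow> x \<in> down P x"
  by (simp add: down_def)

lemma down_subset_iff_mem:
  assumes "x \<in> carrier P" "scott_closed P A"
  shows "down P x \<subseteq> A \<longleftrightarrow> x \<in> A"
  using assms scott_closed_down[of A x] by (auto simp: down_def)

lemma scott_closed_down_set:
  assumes "x \<in> carrier P" shows "scott_closed P (down P x)"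
proof (rule scott_closedI)
  show "down P x \<subseteq> carrier P" by (auto simp: down_def)
  show "z \<in> down P x" if "y \<in> down P x" "z \<in> carrier P" "z \<sqsubseteq> y" for y z
    using that assms le_trans[of z y x] by (simp add: down_def)
  show "\<Squnion>D \<in> down P x" if "directed P D" "D \<subseteq> down P x" for D
    using that sup_in_carrier by (auto simp: down_def intro!: directed_sup_least[OF _ assms])
qed

lemma down_subset_iff:
  assumes "x \<in> carrier P" "y \<in> carrier P"
  shows "down P x \<subseteq> down P y \<longleftrightarrow> x \<sqsubseteq> y"
  using down_subset_iff_mem[OF assms(1) scott_closed_down_set[OF assms(2)]] assms
  by (simp add: down_def)

lemma down_inject:
  assumes "x \<in> carrier P" "y \<in> carrier P" "down P x = down P y"
  shows "x = y"
  using assms down_subset_iff le_antisym by (metis order_refl)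

lemma closure_of_singleton:
  assumes "x \<in> carrier P"
  shows "scott_space P closure_of {x} = down P x"
proof
  show "scott_space P closure_of {x} \<subseteq> down P x"
    using assms in_down_self scott_closed_down_set
    by (intro closure_of_minimal) (auto simp: closedin_scott_space)
  have "scott_closed P (scott_space P closure_of {x})"
    by (simp flip: closedin_scott_space)
  moreover have "x \<in> scott_space P closure_of {x}"
    using closure_of_subset[of "{x}" "scott_space P"] assms by (simp add: topspace_scott_space)
  ultimately show "down P x \<subseteq> scott_space P closure_of {x}"
    using assms down_subset_iff_mem by blast
qed

lemma irreducible_down:
  assumes "x \<in> carrier P" shows "irreducible_in (scott_space P) (down P x)"
  using assms down_subset_iff_mem in_down_self scott_closed_down_set scott_closed_subset
  unfolding irreducible_in_def closedin_scott_space topspace_scott_space by blast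

text \<open>The specialization order of the Scott topology is the given order, so the bound in the
  definition of bounded sobriety is a bound in \<open>P\<close>.\<close>

lemma bounded_sober_irreducible_eq_down:
  assumes sober: "bounded_sober_space (scott_space P)"
    and A: "scott_closed P A" "irreducible_in (scott_space P) A" "A \<noteq> {}"
    and u: "u \<in> carrier P" "A \<subseteq> down P u"
  shows "\<exists>x\<in>carrier P. A = down P x"
proof -
  have "\<exists>u\<in>topspace (scott_space P). \<forall>a\<in>A. specialization_le (scott_space P) a u"
    using u by (auto simp: specialization_le_def closure_of_singleton topspace_scott_space)
  then have "\<exists>x\<in>topspace (scott_space P). A = scott_space P closure_of {x}"
    using sober A unfolding bounded_sober_space_def closedin_scott_space by blast
  then show ?thesis
    by (auto simp: closure_of_singleton topspace_scott_space)
qed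

section \<open>Rudin's lemma\<close>

lemma up_set_mono_le:
  assumes "F \<subseteq> up_set P G" "G \<subseteq> carrier P"
  shows "up_set P F \<subseteq> up_set P G"
  using assms le_trans unfolding up_set_def by blast

text \<open>By finiteness of the members of \<open>\<G>\<close>, Zorn's lemma yields a minimal lower subset \<open>A\<close> of \<open>C\<close>
  that still meets every member. Minimality makes \<open>A\<close> directed: for \<open>a, b \<in> A\<close>, removing all
  elements above \<open>a\<close> makes \<open>A\<close> miss some \<open>F\<^sub>1 \<in> \<G>\<close>, so that every element of \<open>A \<inter> F\<^sub>1\<close> is above
  \<open>a\<close>; likewise every element of \<open>A \<inter> F\<^sub>2\<close> is above \<open>b\<close> for some \<open>F\<^sub>2\<close>; and an element of \<open>A\<close> in a
  common refinement of \<open>F\<^sub>1\<close> and \<open>F\<^sub>2\<close> is above both.\<close>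

lemma Rudin:
  assumes C: "C \<subseteq> carrier P" "\<And>x y. y \<in> C \<Longrightarrow> x \<in> carrier P \<Longrightarrow> x \<sqsubseteq> y \<Longrightarrow> x \<in> C"
    and ne: "\<G> \<noteq> {}"
    and fin: "\<And>F. F \<in> \<G> \<Longrightarrow> finite F"
    and carr: "\<And>F. F \<in> \<G> \<Longrightarrow> F \<subseteq> carrier P"
    and filt: "\<And>F1 F2. F1 \<in> \<G> \<Longrightarrow> F2 \<in> \<G> \<Longrightarrow> \<exists>F\<in>\<G>. F \<subseteq> up_set P F1 \<inter> up_set P F2"
    and meets: "\<And>F. F \<in> \<G> \<Longrightarrow> F \<inter> C \<noteq> {}"
  obtains A where "directed P A" "A \<subseteq> C" "\<forall>F\<in>\<G>. A \<inter> F \<noteq> {}"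
proof -
  \<comment> \<open>the candidates for the complement of \<open>A\<close>\<close>
  define \<U> where "\<U> = {U. (\<forall>x\<in>U. \<forall>y\<in>carrier P. x \<sqsubseteq> y \<longrightarrow> y \<in> U) \<and> (\<forall>F\<in>\<G>. \<not> F \<inter> C \<subseteq> U)}"
  have "{} \<in> \<U>" using meets by (auto simp: \<U>_def)
  moreover have "\<Union>\<C> \<in> \<U>" if ch: "\<C> \<noteq> {}" "subset.chain \<U> \<C>" for \<C>
  proof -
    have sub: "\<C> \<subseteq> \<U>" using ch by (simp add: subset.chain_def)
    have "\<not> F \<inter> C \<subseteq> \<Union>\<C>" if F: "F \<in> \<G>" for F
    proof
      assume "F \<inter> C \<subseteq> \<Union>\<C>"
      then obtain U where "U \<in> \<C>" "F \<inter> C \<subseteq> U"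
        using finite_subset_Union_chain[of "F \<inter> C"] fin[OF F] ch by blast
      then show False using sub F by (auto simp: \<U>_def)
    qed
    then show ?thesis using sub unfolding \<U>_def by blast
  qed
  ultimately obtain U where U: "U \<in> \<U>" and max: "\<And>X. X \<in> \<U> \<Longrightarrow> U \<subseteq> X \<Longrightarrow> X = U"
    using subset_Zorn_nonempty[of \<U>] by (metis empty_iff)
  define A where "A = C - U"
  have upper: "\<And>x y. x \<in> U \<Longrightarrow> y \<in> carrier P \<Longrightarrow> x \<sqsubseteq> y \<Longrightarrow> y \<in> U"
    using U by (simp add: \<U>_def)
  have A_meets: "A \<inter> F \<noteq> {}" if "F \<in> \<G>" for F
    using U that by (auto simp: \<U>_def A_def)
  have A_lower: "x \<in> A" if "y \<in> A" "x \<in> carrier P" "x \<sqsubseteq> y" for x y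
    using that upper[of x y] C(2)[of y x] C(1) by (auto simp: A_def)
  have tail: "\<exists>F\<in>\<G>. \<forall>c \<in> A \<inter> F. a \<sqsubseteq> c" if a: "a \<in> A" for a
  proof -
    let ?X = "U \<union> up_set P {a}"
    have ac: "a \<in> carrier P" using a C by (auto simp: A_def)
    have "a \<in> ?X" "a \<notin> U" using a ac by (auto simp: A_def up_set_def)
    then have "?X \<notin> \<U>" using max[of ?X] by blast
    moreover have "\<forall>x\<in>?X. \<forall>y\<in>carrier P. x \<sqsubseteq> y \<longrightarrow> y \<in> ?X"
      using upper le_trans[OF _ _ ac] by (auto simp: up_set_def)
    ultimately obtain F where "F \<in> \<G>" "F \<inter> C \<subseteq> ?X"
      unfolding \<U>_def by blast
    then show ?thesis by (intro bexI[of _ F]) (auto simp: A_def up_set_def)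
  qed
  have "directed P A"
    unfolding directed_def
  proof (intro conjI ballI)
    show "A \<subseteq> carrier P" using C by (auto simp: A_def)
    show "A \<noteq> {}" using ne A_meets by blast
    fix a b assume a: "a \<in> A" and b: "b \<in> A"
    obtain F1 where F1: "F1 \<in> \<G>" "\<forall>c \<in> A \<inter> F1. a \<sqsubseteq> c" using tail[OF a] by blast
    obtain F2 where F2: "F2 \<in> \<G>" "\<forall>c \<in> A \<inter> F2. b \<sqsubseteq> c" using tail[OF b] by blast
    obtain F where F: "F \<in> \<G>" "F \<subseteq> up_set P F1 \<inter> up_set P F2"
      using filt[OF F1(1) F2(1)] by blast
    obtain c where c: "c \<in> A" "c \<in> F" using A_meets[OF F(1)] by blast
    have cc: "c \<in> carrier P" using c C by (auto simp: A_def)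
    obtain f1 f2 where f: "f1 \<in> F1" "f1 \<sqsubseteq> c" "f2 \<in> F2" "f2 \<sqsubseteq> c"
      using F(2) c(2) unfolding up_set_def by blast
    have fc: "f1 \<in> carrier P" "f2 \<in> carrier P" using f carr F1(1) F2(1) by blast+
    have "f1 \<in> A" "f2 \<in> A" using A_lower[OF c(1)] f fc by blast+
    then have "a \<sqsubseteq> f1" "b \<sqsubseteq> f2" using F1(2) F2(2) f by blast+
    then have "a \<sqsubseteq> c" "b \<sqsubseteq> c"
      using f fc cc a b C(1) le_trans[of a f1 c] le_trans[of b f2 c] by (auto simp: A_def)
    then show "\<exists>z\<in>A. a \<sqsubseteq> z \<and> b \<sqsubseteq> z" using c(1) by blast
  qed
  moreover have "A \<subseteq> C" by (simp add: A_def)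
  ultimately show ?thesis using that[of A] A_meets by blast
qed

end

section \<open>Interpolation in quasicontinuous dcpos\<close>

context dcpo
begin

lemma way_below_up_set_mono:
  assumes "way_below P F z" "F \<subseteq> up_set P G" "G \<subseteq> carrier P"
  shows "way_below P G z"
  using assms up_set_mono_le[OF assms(2,3)] unfolding way_below_def by blast

lemma way_below_le:
  assumes "way_below P F x" "x \<sqsubseteq> z" "x \<in> carrier P" "z \<in> carrier P"
  shows "way_below P F z"
  using assms le_trans[of x z] sup_in_carrier unfolding way_below_def by blast

lemma way_below_imp_mem_up_set:
  assumes "way_below P F z" "z \<in> carrier P"
  shows "z \<in> up_set P F"
proof -
  have "directed P {z} \<and> z \<sqsubseteq> \<Squnion>{z}"
    using assms(2) directed_singleton sup_singleton by simp
  then have "{z} \<inter> up_set P F \<noteq> {}" using assms(1) unfolding way_below_def by blast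
  then show ?thesis by simp
qed

text \<open>Call a set \<open>S\<close> way above \<open>z\<close> if every directed set whose supremum dominates \<open>z\<close> meets \<open>S\<close>;
  this covers both a Scott open neighbourhood of \<open>z\<close> and \<open>S = \<up>F\<close> with \<open>F \<lless> z\<close>. The finite sets \<open>E\<close>
  with \<open>E \<lless> g\<close> for all \<open>g\<close> in some \<open>G \<lless> z\<close> form a filtered family whose upper sets have
  intersection \<open>\<up>z\<close>. If none of them were contained in the upper set \<open>S\<close>, Rudin's lemma would produce
  a directed set outside \<open>S\<close> whose supremum lies above \<open>z\<close>.\<close>

lemma quasicontinuous_interpolation:
  assumes qc: "quasicontinuous P" and z: "z \<in> carrier P"
    and S: "S \<subseteq> carrier P" "\<And>x y. x \<in> S \<Longrightarrow> y \<in> carrier P \<Longrightarrow> x \<sqsubseteq> y \<Longrightarrow> y \<in> S"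
    and way_above: "\<And>D. directed P D \<Longrightarrow> z \<sqsubseteq> \<Squnion>D \<Longrightarrow> D \<inter> S \<noteq> {}"
  obtains (interpolants) G E where "G \<in> fin_below P z" "E \<subseteq> S" "\<forall>g\<in>G. E \<in> fin_below P g"
proof (rule ccontr)
  assume none: "\<not> thesis"
  have contra: "\<not> E \<subseteq> S" if "G \<in> fin_below P z" "\<forall>g\<in>G. E \<in> fin_below P g" for G E
    using none that interpolants by blast
  have fin_ne: "fin_below P x \<noteq> {}" if "x \<in> carrier P" for x
    using qc that unfolding quasicontinuous_def by blast
  have fin_filt: "\<exists>F\<in>fin_below P x. F \<subseteq> up_set P F1 \<inter> up_set P F2"
    if "x \<in> carrier P" "F1 \<in> fin_below P x" "F2 \<in> fin_below P x" for x F1 F2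
    using qc that unfolding quasicontinuous_def by blast
  have fin_sep: "\<exists>F\<in>fin_below P x. y \<notin> up_set P F"
    if "x \<in> carrier P" "y \<in> carrier P" "\<not> x \<sqsubseteq> y" for x y
    using qc that unfolding quasicontinuous_def by blast
  have fin_Union: "(\<Union>g\<in>G. e g) \<in> fin_below P g"
    if G: "G \<in> fin_below P z" and e: "\<And>g. g \<in> G \<Longrightarrow> e g \<in> fin_below P g" and g: "g \<in> G"
    for G e g
  proof -
    have fin: "finite (\<Union>g\<in>G. e g)" and sub: "(\<Union>g\<in>G. e g) \<subseteq> carrier P"
      using G e by (auto simp: fin_below_def)
    have "e g \<subseteq> up_set P (\<Union>g\<in>G. e g)" using sub g le_refl unfolding up_set_def by blast
    moreover have "way_below P (e g) g" using e[OF g] by (simp add: fin_below_def)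
    ultimately have "way_below P (\<Union>g\<in>G. e g) g" using way_below_up_set_mono sub by blast
    then show ?thesis using fin sub by (simp add: fin_below_def)
  qed
  define \<E> where "\<E> = {E. finite E \<and> E \<subseteq> carrier P \<and> (\<exists>G\<in>fin_below P z. \<forall>g\<in>G. E \<in> fin_below P g)}"
  have Union_in: "(\<Union>g\<in>G. e g) \<in> \<E>"
    if G: "G \<in> fin_below P z" and e: "\<And>g. g \<in> G \<Longrightarrow> e g \<in> fin_below P g" for G e
  proof -
    have "\<forall>g\<in>G. (\<Union>g\<in>G. e g) \<in> fin_below P g" using fin_Union[OF G e] by blast
    moreover have "finite (\<Union>g\<in>G. e g)" "(\<Union>g\<in>G. e g) \<subseteq> carrier P"
      using G e by (auto simp: fin_below_def)
    ultimately show ?thesis using G unfolding \<E>_def by blast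
  qed
  obtain A where A: "directed P A" "A \<subseteq> carrier P - S" "\<forall>E\<in>\<E>. A \<inter> E \<noteq> {}"
  proof (rule Rudin[of "carrier P - S" \<E>])
    show "carrier P - S \<subseteq> carrier P" by blast
    show "x \<in> carrier P - S" if "y \<in> carrier P - S" "x \<in> carrier P" "x \<sqsubseteq> y" for x y
      using that S(2)[of x y] by blast
    obtain G where G: "G \<in> fin_below P z" using fin_ne[OF z] by blast
    then have "\<forall>g\<in>G. \<exists>F. F \<in> fin_below P g" using fin_ne unfolding fin_below_def by blast
    then obtain e where "\<forall>g\<in>G. e g \<in> fin_below P g" by metis
    then show "\<E> \<noteq> {}" using Union_in[OF G, of e] by blast
    show "finite E" "E \<subseteq> carrier P" if "E \<in> \<E>" for E
      using that by (auto simp: \<E>_def)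
    show "E \<inter> (carrier P - S) \<noteq> {}" if "E \<in> \<E>" for E
      using that contra unfolding \<E>_def by blast
    show "\<exists>E\<in>\<E>. E \<subseteq> up_set P E1 \<inter> up_set P E2" if E12: "E1 \<in> \<E>" "E2 \<in> \<E>" for E1 E2
    proof -
      obtain G1 where G1: "G1 \<in> fin_below P z" "\<forall>g\<in>G1. E1 \<in> fin_below P g"
        using E12 by (auto simp: \<E>_def)
      obtain G2 where G2: "G2 \<in> fin_below P z" "\<forall>g\<in>G2. E2 \<in> fin_below P g"
        using E12 by (auto simp: \<E>_def)
      obtain G where G: "G \<in> fin_below P z" "G \<subseteq> up_set P G1 \<inter> up_set P G2"
        using fin_filt[OF z G1(1) G2(1)] by blast
      have "\<exists>F. F \<in> fin_below P g \<and> F \<subseteq> up_set P E1 \<inter> up_set P E2" if g: "g \<in> G" for g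
      proof -
        have gc: "g \<in> carrier P" using G g by (auto simp: fin_below_def)
        have up: "E \<in> fin_below P g" if "h \<in> carrier P" "h \<sqsubseteq> g" "E \<in> fin_below P h" for E h
          using that gc way_below_le[of E h g] by (simp add: fin_below_def)
        obtain g1 g2 where h: "g1 \<in> G1" "g1 \<sqsubseteq> g" "g2 \<in> G2" "g2 \<sqsubseteq> g"
          using G(2) g unfolding up_set_def by blast
        moreover have "g1 \<in> carrier P" "g2 \<in> carrier P"
          using h G1(1) G2(1) by (auto simp: fin_below_def)
        ultimately have "E1 \<in> fin_below P g" "E2 \<in> fin_below P g"
          using up G1(2) G2(2) by blast+
        then show ?thesis using fin_filt[OF gc] by blast
      qed
      then obtain e where e: "\<And>g. g \<in> G \<Longrightarrow> e g \<in> fin_below P g"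
          "\<And>g. g \<in> G \<Longrightarrow> e g \<subseteq> up_set P E1 \<inter> up_set P E2"
        by metis
      have "(\<Union>g\<in>G. e g) \<in> \<E>" by (rule Union_in[OF G(1) e(1)])
      moreover have "(\<Union>g\<in>G. e g) \<subseteq> up_set P E1 \<inter> up_set P E2" using e(2) by blast
      ultimately show ?thesis by blast
    qed
  qed
  have s: "\<Squnion>A \<in> carrier P" by (rule sup_in_carrier[OF A(1)])
  have "z \<sqsubseteq> \<Squnion>A"
  proof (rule ccontr)
    assume "\<not> z \<sqsubseteq> \<Squnion>A"
    then obtain G where G: "G \<in> fin_below P z" "\<Squnion>A \<notin> up_set P G"
      using fin_sep[OF z s] by blast
    have "\<exists>F. F \<in> fin_below P g \<and> \<Squnion>A \<notin> up_set P F" if "g \<in> G" for g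
    proof -
      have "g \<in> carrier P" "\<not> g \<sqsubseteq> \<Squnion>A"
        using G that s by (auto simp: fin_below_def up_set_def)
      then show ?thesis using fin_sep[OF _ s] by blast
    qed
    then obtain e where e: "\<And>g. g \<in> G \<Longrightarrow> e g \<in> fin_below P g"
        "\<And>g. g \<in> G \<Longrightarrow> \<Squnion>A \<notin> up_set P (e g)"
      by metis
    obtain a where "a \<in> A" "a \<in> (\<Union>g\<in>G. e g)"
      using A(3) Union_in[OF G(1) e(1)] by blast
    then show False
      using e(2) directed_sup_upper[OF A(1)] s unfolding up_set_def by blast
  qed
  then show False using way_above[OF A(1)] A(2) by blast
qed

text \<open>Interpolation for \<open>S = \<up>F\<close> says that \<open>F \<lless> \<Squnion>D\<close> already forces \<open>F \<lless> d\<close> for some \<open>d \<in> D\<close>.\<close>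

lemma scott_closed_not_way_below:
  assumes qc: "quasicontinuous P" and F: "F \<subseteq> carrier P"
  shows "scott_closed P {z \<in> carrier P. \<not> way_below P F z}"
proof (rule scott_closedI)
  show "x \<in> {z \<in> carrier P. \<not> way_below P F z}"
    if "y \<in> {z \<in> carrier P. \<not> way_below P F z}" "x \<in> carrier P" "x \<sqsubseteq> y" for x y
    using that way_below_le[of F x y] by blast
  fix D assume D: "directed P D" "D \<subseteq> {z \<in> carrier P. \<not> way_below P F z}"
  have False if wb: "way_below P F (\<Squnion>D)"
  proof -
    obtain G E where GE: "G \<in> fin_below P (\<Squnion>D)" "E \<subseteq> up_set P F"
        "\<forall>g\<in>G. E \<in> fin_below P g"
    proof (rule quasicontinuous_interpolation[OF qc, of "\<Squnion>D" "up_set P F"])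
      show "\<Squnion>D \<in> carrier P" by (rule sup_in_carrier[OF D(1)])
      show "up_set P F \<subseteq> carrier P" by (auto simp: up_set_def)
      show "y \<in> up_set P F" if "x \<in> up_set P F" "y \<in> carrier P" "x \<sqsubseteq> y" for x y
        using that F le_trans[of _ x y] unfolding up_set_def by blast
    qed (use wb in \<open>auto simp: way_below_def\<close>)
    have "\<Squnion>D \<sqsubseteq> \<Squnion>D" using sup_in_carrier[OF D(1)] by blast
    then have "D \<inter> up_set P G \<noteq> {}"
      using D(1) GE(1) unfolding fin_below_def way_below_def by blast
    then obtain d g where d: "d \<in> D" "g \<in> G" "g \<sqsubseteq> d" "d \<in> carrier P"
      unfolding up_set_def by blast
    have "way_below P F g"
      using way_below_up_set_mono[OF _ GE(2) F] GE(3) d(2) by (simp add: fin_below_def)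
    then have "way_below P F d"
      using d GE(1) way_below_le by (auto simp: fin_below_def)
    then show False using D(2) d(1) by blast
  qed
  then show "\<Squnion>D \<in> {z \<in> carrier P. \<not> way_below P F z}"
    using sup_in_carrier[OF D(1)] by blast
qed blast

lemma quasicontinuous_fin_below_open:
  assumes qc: "quasicontinuous P" and C: "scott_closed P C" and z: "z \<in> carrier P" "z \<notin> C"
  obtains F where "F \<in> fin_below P z" "F \<inter> C = {}"
proof -
  have below: "x \<sqsubseteq> \<Squnion>D \<Longrightarrow> x \<in> C" if "x \<in> carrier P" "directed P D" "D \<subseteq> C" for x D
    using scott_closed_down[OF C] scott_closed_sup[OF C that(2,3)] that(1) by blast
  obtain G E where GE: "G \<in> fin_below P z" "E \<subseteq> carrier P - C"
      "\<forall>g\<in>G. E \<in> fin_below P g"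
  proof (rule quasicontinuous_interpolation[OF qc z(1), of "carrier P - C"])
    show "y \<in> carrier P - C" if "x \<in> carrier P - C" "y \<in> carrier P" "x \<sqsubseteq> y" for x y
      using that scott_closed_down[OF C] by blast
    show "D \<inter> (carrier P - C) \<noteq> {}" if "directed P D" "z \<sqsubseteq> \<Squnion>D" for D
      using that below[OF z(1)] z(2) unfolding directed_def by blast
  qed auto
  have "g \<notin> C" if g: "g \<in> G" for g
  proof -
    have gc: "g \<in> carrier P" using g GE(1) by (auto simp: fin_below_def)
    have "g \<in> up_set P E"
      using GE(3) g gc way_below_imp_mem_up_set by (simp add: fin_below_def)
    then obtain e where "e \<in> E" "e \<sqsubseteq> g" by (auto simp: up_set_def)
    then show ?thesis using GE(2) scott_closed_down[OF C] by blast
  qed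
  then show ?thesis using that GE(1) by blast
qed

end

section \<open>Hypercontinuity as a property of closed set lattices\<close>

text \<open>Only inclusions between closed sets occur here, so every isomorphism of closed set lattices
  preserves the property. Passing to complements, with \<open>V\<close> and \<open>C\<close> turned into open sets
  \<open>W \<subseteq> U\<close> of the subspace \<open>X\<close>, it says that \<open>U\<close> is the union of those \<open>W\<close> for which all open sets
  in some neighbourhood of \<open>U\<close>, in the upper topology on the lattice of open sets, contain \<open>W\<close>. This
  is hypercontinuity in the sense of Gierz and Lawson.\<close>

definition hypercontinuous_on :: "('a, 'm) gorder_scheme \<Rightarrow> 'a set \<Rightarrow> bool" where
  "hypercontinuous_on P X \<longleftrightarrow>
     (\<forall>C Y. scott_closed P C \<and> scott_closed P Y \<and> Y \<subseteq> X \<and> \<not> Y \<subseteq> C \<longrightarrow>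
        (\<exists>V \<K>. scott_closed P V \<and> \<not> Y \<subseteq> V \<and>
           finite \<K> \<and> (\<forall>K\<in>\<K>. scott_closed P K \<and> \<not> K \<subseteq> C) \<and>
           (\<forall>Z. scott_closed P Z \<and> Z \<subseteq> X \<and> (\<forall>K\<in>\<K>. \<not> K \<subseteq> Z) \<longrightarrow> Z \<subseteq> V)))"

lemma hypercontinuous_onE:
  assumes "hypercontinuous_on P X" "scott_closed P C" "scott_closed P Y" "Y \<subseteq> X" "\<not> Y \<subseteq> C"
  obtains V \<K> where "scott_closed P V" "\<not> Y \<subseteq> V" "finite \<K>"
    "\<forall>K\<in>\<K>. scott_closed P K \<and> \<not> K \<subseteq> C"
    "\<forall>Z. scott_closed P Z \<and> Z \<subseteq> X \<and> (\<forall>K\<in>\<K>. \<not> K \<subseteq> Z) \<longrightarrow> Z \<subseteq> V"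
proof -
  have "\<exists>V \<K>. scott_closed P V \<and> \<not> Y \<subseteq> V \<and>
      finite \<K> \<and> (\<forall>K\<in>\<K>. scott_closed P K \<and> \<not> K \<subseteq> C) \<and>
      (\<forall>Z. scott_closed P Z \<and> Z \<subseteq> X \<and> (\<forall>K\<in>\<K>. \<not> K \<subseteq> Z) \<longrightarrow> Z \<subseteq> V)"
    using assms(1) unfolding hypercontinuous_on_def by (elim allE impE) (use assms in auto)
  then show ?thesis by (elim exE conjE, intro that) assumption+
qed

text \<open>Given a point \<open>p\<close> of \<open>Y\<close> outside \<open>C\<close>, take a finite \<open>F \<lless> p\<close> disjoint from \<open>C\<close>. The principal
  ideals of the members of \<open>F\<close> serve as \<open>\<K>\<close>, and the complement of \<open>{z. F \<lless> z}\<close> serves as \<open>V\<close>.\<close>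

lemma (in dcpo) quasicontinuous_hypercontinuous:
  assumes qc: "quasicontinuous P"
  shows "hypercontinuous_on P (carrier P)"
  unfolding hypercontinuous_on_def
proof (intro allI impI, elim conjE)
  fix C Y assume C: "scott_closed P C" and Y: "scott_closed P Y" "\<not> Y \<subseteq> C"
  then obtain p where p: "p \<in> Y" "p \<notin> C" "p \<in> carrier P"
    using scott_closed_subset by blast
  obtain F where F: "F \<in> fin_below P p" "F \<inter> C = {}"
    using quasicontinuous_fin_below_open[OF qc C p(3,2)] .
  have Fc: "finite F" "F \<subseteq> carrier P" "way_below P F p"
    using F(1) by (auto simp: fin_below_def)
  let ?V = "{z \<in> carrier P. \<not> way_below P F z}"
  have "Z \<subseteq> ?V" if Z: "scott_closed P Z" and miss: "\<forall>K\<in>down P ` F. \<not> K \<subseteq> Z" for Z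
  proof
    fix z assume z: "z \<in> Z"
    then have zc: "z \<in> carrier P" using scott_closed_subset[OF Z] by blast
    have "\<not> way_below P F z"
    proof
      assume "way_below P F z"
      then have "z \<in> up_set P F" using zc by (rule way_below_imp_mem_up_set)
      then obtain f where f: "f \<in> F" "f \<sqsubseteq> z" by (auto simp: up_set_def)
      then have "f \<in> Z" using Fc scott_closed_down[OF Z z] by blast
      then show False using miss f(1) Fc(2) down_subset_iff_mem[OF _ Z] by blast
    qed
    then show "z \<in> ?V" using zc by blast
  qed
  moreover have "scott_closed P K \<and> \<not> K \<subseteq> C" if "K \<in> down P ` F" for K
    using that Fc(2) F(2) scott_closed_down_set down_subset_iff_mem[OF _ C] by blast
  moreover have "scott_closed P ?V" by (rule scott_closed_not_way_below[OF qc Fc(2)])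
  moreover have "\<not> Y \<subseteq> ?V" using p Fc(3) by blast
  moreover have "finite (down P ` F)" using Fc(1) by simp
  ultimately show "\<exists>V \<K>. scott_closed P V \<and> \<not> Y \<subseteq> V \<and>
      finite \<K> \<and> (\<forall>K\<in>\<K>. scott_closed P K \<and> \<not> K \<subseteq> C) \<and>
      (\<forall>Z. scott_closed P Z \<and> Z \<subseteq> carrier P \<and> (\<forall>K\<in>\<K>. \<not> K \<subseteq> Z) \<longrightarrow> Z \<subseteq> V)"
    by (intro exI[of _ ?V] exI[of _ "down P ` F"]) blast
qed

context dcpo
begin

lemma directed_sub_down: "directed (sub_down P x) D \<longleftrightarrow> directed P D \<and> D \<subseteq> down P x"
  by (auto simp: directed_def sub_down_def down_def)

lemma sup_sub_down:
  assumes x: "x \<in> carrier P" and D: "directed P D" "D \<subseteq> down P x"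
    and dcpo: "dcpo (sub_down P x)"
  shows "\<Squnion>\<^bsub>sub_down P x\<^esub> D = \<Squnion>D"
proof -
  interpret R: dcpo "sub_down P x" by fact
  have "\<Squnion>D \<in> down P x" using scott_closed_sup[OF scott_closed_down_set[OF x] D] .
  then have "is_lub (sub_down P x) (\<Squnion>D) D"
    using D directed_sup_upper[OF D(1)]
    by (intro least_UpperI)
      (auto simp: sub_down_def down_def Upper_def intro!: directed_sup_least[OF D(1)])
  then show ?thesis by (rule R.sup_eqI)
qed

lemma scott_closed_sub_down:
  assumes x: "x \<in> carrier P" and dcpo: "dcpo (sub_down P x)"
  shows "scott_closed (sub_down P x) A \<longleftrightarrow> scott_closed P A \<and> A \<subseteq> down P x"
proof
  assume A: "scott_closed (sub_down P x) A"
  have Ax: "A \<subseteq> down P x" using A by (auto simp: scott_closed_def sub_down_def down_def)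
  have "scott_closed P A"
  proof (rule scott_closedI)
    show "A \<subseteq> carrier P" using Ax by (auto simp: down_def)
    show "z \<in> A" if "y \<in> A" "z \<in> carrier P" "z \<sqsubseteq> y" for y z
      using that A Ax scott_closed_down[OF scott_closed_down_set[OF x], of y z]
      by (auto simp: scott_closed_def sub_down_def down_def)
    show "\<Squnion>D \<in> A" if D: "directed P D" "D \<subseteq> A" for D
      using A D Ax sup_sub_down[OF x D(1) _ dcpo] directed_sub_down[of x D]
      unfolding scott_closed_def by auto
  qed
  then show "scott_closed P A \<and> A \<subseteq> down P x" using Ax by blast
next
  assume A: "scott_closed P A \<and> A \<subseteq> down P x"
  then show "scott_closed (sub_down P x) A"
    using sup_sub_down[OF x _ _ dcpo] directed_sub_down[of x]
    unfolding scott_closed_def by (auto simp: sub_down_def down_def)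
qed

lemma quasicontinuous_element_hypercontinuous:
  assumes "quasicontinuous_element P x"
  shows "hypercontinuous_on P (down P x)"
proof -
  have x: "x \<in> carrier P" and qc: "quasicontinuous (sub_down P x)"
    using assms by (auto simp: quasicontinuous_element_def)
  then have dcpo: "dcpo (sub_down P x)" by (simp add: quasicontinuous_def)
  note closed = scott_closed_sub_down[OF x dcpo]
  have carr: "carrier (sub_down P x) = down P x" by (simp add: sub_down_def down_def)
  have hyp: "hypercontinuous_on (sub_down P x) (down P x)"
    using dcpo.quasicontinuous_hypercontinuous[OF dcpo qc] by (simp add: carr)
  show ?thesis
    unfolding hypercontinuous_on_def
  proof (intro allI impI, elim conjE)
    fix C Y assume C: "scott_closed P C" and Y: "scott_closed P Y" "Y \<subseteq> down P x" "\<not> Y \<subseteq> C"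
    let ?C = "C \<inter> down P x"
    have C': "scott_closed (sub_down P x) ?C" and Y': "scott_closed (sub_down P x) Y"
      using scott_closed_Int[OF C scott_closed_down_set[OF x]] Y by (simp_all add: closed)
    have YC: "\<not> Y \<subseteq> ?C" using Y(3) by blast
    obtain V \<K> where V: "scott_closed (sub_down P x) V" "\<not> Y \<subseteq> V" and \<K>: "finite \<K>"
        "\<forall>K\<in>\<K>. scott_closed (sub_down P x) K \<and> \<not> K \<subseteq> ?C"
      and upper: "\<forall>Z. scott_closed (sub_down P x) Z \<and> Z \<subseteq> down P x \<and> (\<forall>K\<in>\<K>. \<not> K \<subseteq> Z) \<longrightarrow> Z \<subseteq> V"
      using hypercontinuous_onE[OF hyp C' Y' Y(2) YC] .
    have "\<forall>K\<in>\<K>. scott_closed P K \<and> \<not> K \<subseteq> C" using \<K>(2) closed by blast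
    then show "\<exists>V \<K>. scott_closed P V \<and> \<not> Y \<subseteq> V \<and>
        finite \<K> \<and> (\<forall>K\<in>\<K>. scott_closed P K \<and> \<not> K \<subseteq> C) \<and>
        (\<forall>Z. scott_closed P Z \<and> Z \<subseteq> down P x \<and> (\<forall>K\<in>\<K>. \<not> K \<subseteq> Z) \<longrightarrow> Z \<subseteq> V)"
      using V \<K>(1) upper closed by (intro exI[of _ V] exI[of _ \<K>]) simp
  qed
qed

text \<open>Choosing a point outside \<open>C\<close> in each member of \<open>\<K>\<close> turns hypercontinuity back into a statement
  about finite sets: every point of \<open>B\<close> has small neighbourhoods in \<open>B\<close> of the form \<open>\<up>F \<inter> B\<close>, \<open>F\<close>
  finite. Chosen points outside \<open>B\<close> can be dropped, as they are below no point of \<open>B\<close>.\<close>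

lemma hypercontinuous_finite_neighbourhood:
  assumes hyp: "hypercontinuous_on P B" and B: "scott_closed P B"
    and C: "scott_closed P C" and q: "q \<in> B" "q \<notin> C"
  obtains F V where "finite F" "F \<subseteq> B - C" "scott_closed P V" "q \<notin> V" "B - V \<subseteq> up_set P F"
proof -
  have qc: "q \<in> carrier P" using q scott_closed_subset[OF B] by blast
  have qB: "down P q \<subseteq> B" and qC: "\<not> down P q \<subseteq> C"
    using down_subset_iff_mem[OF qc] B C q by blast+
  obtain V \<K> where V: "scott_closed P V" "\<not> down P q \<subseteq> V" and \<K>: "finite \<K>"
      "\<forall>K\<in>\<K>. scott_closed P K \<and> \<not> K \<subseteq> C"
    and upper: "\<forall>Z. scott_closed P Z \<and> Z \<subseteq> B \<and> (\<forall>K\<in>\<K>. \<not> K \<subseteq> Z) \<longrightarrow> Z \<subseteq> V"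
    using hypercontinuous_onE[OF hyp C scott_closed_down_set[OF qc] qB qC] .
  have "\<exists>k. \<forall>K\<in>\<K>. k K \<in> K - C" using \<K>(2) by (intro bchoice) blast
  then obtain k where k: "\<forall>K\<in>\<K>. k K \<in> K - C" ..
  show ?thesis
  proof (rule that[of "k ` \<K> \<inter> B" V])
    show "finite (k ` \<K> \<inter> B)" using \<K>(1) by simp
    show "k ` \<K> \<inter> B \<subseteq> B - C" using k by blast
    show "scott_closed P V" by (rule V)
    show "q \<notin> V" using V down_subset_iff_mem[OF qc] by blast
    show "B - V \<subseteq> up_set P (k ` \<K> \<inter> B)"
    proof
      fix z assume z: "z \<in> B - V"
      then have zc: "z \<in> carrier P" using scott_closed_subset[OF B] by blast
      have zB: "down P z \<subseteq> B" and "\<not> down P z \<subseteq> V"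
        using z down_subset_iff_mem[OF zc] B V(1) by blast+
      then obtain K where K: "K \<in> \<K>" "K \<subseteq> down P z"
        using upper scott_closed_down_set[OF zc] by blast
      then have "k K \<in> B" "k K \<sqsubseteq> z" using bspec[OF k K(1)] K(2) zB by (auto simp: down_def)
      then show "z \<in> up_set P (k ` \<K> \<inter> B)" using K(1) zc by (auto simp: up_set_def)
    qed
  qed
qed

text \<open>The finite sets whose upper set has nonempty interior in \<open>B\<close> form a filtered family, because
  nonempty open subsets of the irreducible set \<open>B\<close> intersect. Rudin's lemma gives a directed set in
  \<open>B\<close> meeting all of them, hence meeting every nonempty open subset of \<open>B\<close>; its supremum is the
  greatest element of \<open>B\<close>.\<close>

lemma hypercontinuous_irreducible_eq_down:
  assumes hyp: "hypercontinuous_on P B" and B: "scott_closed P B"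
    and irr: "irreducible_in (scott_space P) B" and ne: "B \<noteq> {}"
  shows "\<exists>y\<in>carrier P. B = down P y"
proof -
  have Bc: "B \<subseteq> carrier P" by (rule scott_closed_subset[OF B])
  define \<F> where "\<F> = {F. finite F \<and> F \<subseteq> B \<and>
    (\<exists>V. scott_closed P V \<and> \<not> B \<subseteq> V \<and> B - V \<subseteq> up_set P F)}"
  have nbhd: "\<exists>F\<in>\<F>. F \<inter> C = {}" if C: "scott_closed P C" and BC: "\<not> B \<subseteq> C" for C
  proof -
    obtain q where q: "q \<in> B" "q \<notin> C" using BC by blast
    obtain F V where "finite F" "F \<subseteq> B - C" "scott_closed P V" "q \<notin> V" "B - V \<subseteq> up_set P F"
      using hypercontinuous_finite_neighbourhood[OF hyp B C q] .
    then show ?thesis using q(1) by (intro bexI[of _ F]) (auto simp: \<F>_def)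
  qed
  obtain A where A: "directed P A" "A \<subseteq> B" "\<forall>F\<in>\<F>. A \<inter> F \<noteq> {}"
  proof (rule Rudin[of B \<F>])
    show "B \<subseteq> carrier P" by (rule Bc)
    show "x \<in> B" if "y \<in> B" "x \<in> carrier P" "x \<sqsubseteq> y" for x y
      using scott_closed_down[OF B] that by blast
    show "\<F> \<noteq> {}" using nbhd[OF scott_closed_empty] ne by blast
    show "finite F" "F \<subseteq> carrier P" if "F \<in> \<F>" for F
      using that Bc by (auto simp: \<F>_def)
    show "F \<inter> B \<noteq> {}" if "F \<in> \<F>" for F
      using that unfolding \<F>_def up_set_def by blast
    show "\<exists>F\<in>\<F>. F \<subseteq> up_set P F1 \<inter> up_set P F2" if F12: "F1 \<in> \<F>" "F2 \<in> \<F>" for F1 F2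
    proof -
      obtain V1 where V1: "scott_closed P V1" "\<not> B \<subseteq> V1" "B - V1 \<subseteq> up_set P F1"
        using F12(1) by (auto simp: \<F>_def)
      obtain V2 where V2: "scott_closed P V2" "\<not> B \<subseteq> V2" "B - V2 \<subseteq> up_set P F2"
        using F12(2) by (auto simp: \<F>_def)
      have "\<not> B \<subseteq> V1 \<union> V2"
        using irr V1(1,2) V2(1,2) unfolding irreducible_in_def closedin_scott_space by blast
      then obtain F where F: "F \<in> \<F>" "F \<inter> (V1 \<union> V2) = {}"
        using nbhd[OF scott_closed_Un[OF V1(1) V2(1)]] by blast
      moreover have "F \<subseteq> B" using F(1) by (simp add: \<F>_def)
      ultimately have "F \<subseteq> up_set P F1 \<inter> up_set P F2" using V1(3) V2(3) by blast
      then show ?thesis using F(1) by blast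
    qed
  qed
  have s: "\<Squnion>A \<in> B" by (rule scott_closed_sup[OF B A(1,2)])
  then have sc: "\<Squnion>A \<in> carrier P" using Bc by blast
  have "B \<subseteq> down P (\<Squnion>A)"
  proof (rule ccontr)
    assume "\<not> B \<subseteq> down P (\<Squnion>A)"
    then obtain F where F: "F \<in> \<F>" "F \<inter> down P (\<Squnion>A) = {}"
      using nbhd[OF scott_closed_down_set[OF sc]] by blast
    then obtain a where a: "a \<in> A" "a \<in> F" using A(3) by blast
    then have "a \<in> down P (\<Squnion>A)"
      using A(2) Bc directed_sup_upper[OF A(1)] by (auto simp: down_def)
    then show False using F(2) a(2) by blast
  qed
  then have "B = down P (\<Squnion>A)" using down_subset_iff_mem[OF sc B] s by blast
  then show ?thesis using sc by blast
qed

end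

section \<open>Isomorphisms of closed set lattices\<close>

text \<open>The inverse map is a parameter, so that the assumptions are symmetric and every
  result proved for \<open>\<phi>\<close> is also available for \<open>\<psi>\<close>.\<close>

locale closed_lattice_iso = P: dcpo P + Q: dcpo Q
  for P :: "('a, 'm) gorder_scheme" and Q :: "('b, 'n) gorder_scheme" +
  fixes \<phi> :: "'a set \<Rightarrow> 'b set" and \<psi> :: "'b set \<Rightarrow> 'a set"
  assumes phi_closed: "scott_closed P A \<Longrightarrow> scott_closed Q (\<phi> A)"
    and psi_closed: "scott_closed Q B \<Longrightarrow> scott_closed P (\<psi> B)"
    and psi_phi: "scott_closed P A \<Longrightarrow> \<psi> (\<phi> A) = A"
    and phi_psi: "scott_closed Q B \<Longrightarrow> \<phi> (\<psi> B) = B"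
    and phi_mono: "scott_closed P A \<Longrightarrow> scott_closed P A' \<Longrightarrow> A \<subseteq> A' \<Longrightarrow> \<phi> A \<subseteq> \<phi> A'"
    and psi_mono: "scott_closed Q B \<Longrightarrow> scott_closed Q B' \<Longrightarrow> B \<subseteq> B' \<Longrightarrow> \<psi> B \<subseteq> \<psi> B'"
begin

lemma flipped: "closed_lattice_iso Q P \<psi> \<phi>"
  by unfold_locales (rule phi_closed psi_closed psi_phi phi_psi phi_mono psi_mono; assumption)+

lemma phi_subset_iff:
  assumes "scott_closed P A" "scott_closed Q B"
  shows "\<phi> A \<subseteq> B \<longleftrightarrow> A \<subseteq> \<psi> B"
  using phi_mono[OF assms(1) psi_closed[OF assms(2)]] psi_mono[OF phi_closed[OF assms(1)] assms(2)]
    psi_phi[OF assms(1)] phi_psi[OF assms(2)] by auto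

lemma phi_subset_phi_iff:
  assumes "scott_closed P A" "scott_closed P A'"
  shows "\<phi> A \<subseteq> \<phi> A' \<longleftrightarrow> A \<subseteq> A'"
  using phi_subset_iff[OF assms(1) phi_closed[OF assms(2)]] psi_phi[OF assms(2)] by simp

lemma phi_nonempty:
  assumes "scott_closed P A" "A \<noteq> {}" shows "\<phi> A \<noteq> {}"
  using phi_subset_phi_iff[OF assms(1) P.scott_closed_empty] assms(2) by auto

lemma irreducible_phi:
  assumes A: "scott_closed P A" and irr: "irreducible_in (scott_space P) A"
  shows "irreducible_in (scott_space Q) (\<phi> A)"
  unfolding irreducible_in_def Q.closedin_scott_space Q.topspace_scott_space
proof (intro conjI allI impI; (elim conjE)?)
  show "\<phi> A \<subseteq> carrier Q" by (rule Q.scott_closed_subset[OF phi_closed[OF A]])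
  fix F1 F2 assume F: "scott_closed Q F1" "scott_closed Q F2" and sub: "\<phi> A \<subseteq> F1 \<union> F2"
  have H: "scott_closed P (\<psi> F1 \<union> \<psi> F2)"
    using F by (intro P.scott_closed_Un psi_closed)
  have "F1 \<subseteq> \<phi> (\<psi> F1 \<union> \<psi> F2)" "F2 \<subseteq> \<phi> (\<psi> F1 \<union> \<psi> F2)"
    using F H phi_mono[OF _ H] psi_closed phi_psi by (metis Un_upper1, metis Un_upper2)
  then have "\<phi> A \<subseteq> \<phi> (\<psi> F1 \<union> \<psi> F2)" using sub by blast
  then have "A \<subseteq> \<psi> F1 \<union> \<psi> F2" using phi_subset_phi_iff[OF A H] by blast
  then have "A \<subseteq> \<psi> F1 \<or> A \<subseteq> \<psi> F2"
    using irr F psi_closed unfolding irreducible_in_def P.closedin_scott_space by blast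
  then show "\<phi> A \<subseteq> F1 \<or> \<phi> A \<subseteq> F2" using phi_subset_iff[OF A] F by blast
qed

lemma hypercontinuous_phi:
  assumes A: "scott_closed P A" and hyp: "hypercontinuous_on P A"
  shows "hypercontinuous_on Q (\<phi> A)"
  unfolding hypercontinuous_on_def
proof (intro allI impI, elim conjE)
  interpret flip: closed_lattice_iso Q P \<psi> \<phi> by (rule flipped)
  fix C Y assume C: "scott_closed Q C" and Y: "scott_closed Q Y" "Y \<subseteq> \<phi> A" "\<not> Y \<subseteq> C"
  have YA: "\<psi> Y \<subseteq> A" using Y flip.phi_subset_iff[OF Y(1) A] by blast
  have YC: "\<not> \<psi> Y \<subseteq> \<psi> C" using Y(3) flip.phi_subset_phi_iff[OF Y(1) C] by blast
  obtain V \<K> where V: "scott_closed P V" "\<not> \<psi> Y \<subseteq> V" and fin: "finite \<K>"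
    and \<K>: "\<forall>K\<in>\<K>. scott_closed P K \<and> \<not> K \<subseteq> \<psi> C"
    and upper: "\<forall>Z. scott_closed P Z \<and> Z \<subseteq> A \<and> (\<forall>K\<in>\<K>. \<not> K \<subseteq> Z) \<longrightarrow> Z \<subseteq> V"
    using hypercontinuous_onE[OF hyp psi_closed[OF C] psi_closed[OF Y(1)] YA YC] .
  have 1: "scott_closed Q (\<phi> V)" "\<not> Y \<subseteq> \<phi> V" "finite (\<phi> ` \<K>)"
    using V fin phi_closed flip.phi_subset_iff[OF Y(1) V(1)] by auto
  have 2: "\<forall>K\<in>\<phi> ` \<K>. scott_closed Q K \<and> \<not> K \<subseteq> C"
    using \<K> phi_closed phi_subset_iff[OF _ C] by blast
  have 3: "Z \<subseteq> \<phi> V"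
    if Z: "scott_closed Q Z" "Z \<subseteq> \<phi> A" and miss: "\<forall>K\<in>\<phi> ` \<K>. \<not> K \<subseteq> Z" for Z
  proof -
    have "\<forall>K\<in>\<K>. \<not> K \<subseteq> \<psi> Z" using miss \<K> phi_subset_iff[OF _ Z(1)] by blast
    then have "\<psi> Z \<subseteq> V"
      using upper psi_closed[OF Z(1)] Z(2) flip.phi_subset_iff[OF Z(1) A] by blast
    then show ?thesis using flip.phi_subset_iff[OF Z(1) V(1)] by blast
  qed
  show "\<exists>V \<K>. scott_closed Q V \<and> \<not> Y \<subseteq> V \<and>
      finite \<K> \<and> (\<forall>K\<in>\<K>. scott_closed Q K \<and> \<not> K \<subseteq> C) \<and>
      (\<forall>Z. scott_closed Q Z \<and> Z \<subseteq> \<phi> A \<and> (\<forall>K\<in>\<K>. \<not> K \<subseteq> Z) \<longrightarrow> Z \<subseteq> V)"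
    by (intro exI[of _ "\<phi> V"] exI[of _ "\<phi> ` \<K>"] conjI 1 2 allI impI; elim conjE; rule 3)
qed

lemma quasicontinuous_element_image:
  assumes "quasicontinuous_element P x"
  shows "\<exists>y\<in>carrier Q. \<phi> (down P x) = down Q y"
proof -
  have x: "x \<in> carrier P" using assms by (simp add: quasicontinuous_element_def)
  note cl = P.scott_closed_down_set[OF x]
  show ?thesis
  proof (rule Q.hypercontinuous_irreducible_eq_down)
    show "hypercontinuous_on Q (\<phi> (down P x))"
      by (rule hypercontinuous_phi[OF cl P.quasicontinuous_element_hypercontinuous[OF assms]])
    show "scott_closed Q (\<phi> (down P x))" by (rule phi_closed[OF cl])
    show "irreducible_in (scott_space Q) (\<phi> (down P x))"
      by (rule irreducible_phi[OF cl P.irreducible_down[OF x]])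
    show "\<phi> (down P x) \<noteq> {}" using phi_nonempty[OF cl] P.in_down_self[OF x] by blast
  qed
qed

lemma mem_psi_iff:
  assumes "x \<in> carrier P" "y \<in> carrier Q" "\<phi> (down P x) = down Q y" "scott_closed Q B"
  shows "x \<in> \<psi> B \<longleftrightarrow> y \<in> B"
  using phi_subset_iff[OF P.scott_closed_down_set[OF assms(1)] assms(4)] assms(3)
    P.down_subset_iff_mem[OF assms(1) psi_closed[OF assms(4)]] Q.down_subset_iff_mem[OF assms(2,4)]
  by simp

lemma le_iff_of_images:
  assumes "x \<in> carrier P" "x' \<in> carrier P" "y \<in> carrier Q" "y' \<in> carrier Q"
    and "\<phi> (down P x) = down Q y" "\<phi> (down P x') = down Q y'"
  shows "y \<sqsubseteq>\<^bsub>Q\<^esub> y' \<longleftrightarrow> x \<sqsubseteq>\<^bsub>P\<^esub> x'"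
  using phi_subset_phi_iff[OF P.scott_closed_down_set[OF assms(1)]
      P.scott_closed_down_set[OF assms(2)]]
    P.down_subset_iff[OF assms(1,2)] Q.down_subset_iff[OF assms(3,4)] assms(5,6)
  by simp

text \<open>\<open>\<phi>\<close> preserves joins of closed sets, and in both dcpos the principal ideal of a directed supremum
  is the join of the principal ideals of the members.\<close>

lemma image_of_directed_sup:
  assumes D: "directed P D"
    and f: "\<And>d. d \<in> D \<Longrightarrow> f d \<in> carrier Q" "\<And>d. d \<in> D \<Longrightarrow> \<phi> (down P d) = down Q (f d)"
  shows "directed Q (f ` D)" and "\<phi> (down P (\<Squnion>\<^bsub>P\<^esub>D)) = down Q (\<Squnion>\<^bsub>Q\<^esub>(f ` D))"
proof -
  have Dc: "D \<subseteq> carrier P" using D by (simp add: directed_def)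
  show fD: "directed Q (f ` D)"
    unfolding directed_def
  proof (intro conjI ballI)
    show "f ` D \<subseteq> carrier Q" "f ` D \<noteq> {}" using f D by (auto simp: directed_def)
    fix u v assume "u \<in> f ` D" "v \<in> f ` D"
    then obtain a b where ab: "a \<in> D" "u = f a" "b \<in> D" "v = f b" by blast
    then obtain c where c: "c \<in> D" "a \<sqsubseteq>\<^bsub>P\<^esub> c" "b \<sqsubseteq>\<^bsub>P\<^esub> c"
      using D unfolding directed_def by blast
    then have "f a \<sqsubseteq>\<^bsub>Q\<^esub> f c" "f b \<sqsubseteq>\<^bsub>Q\<^esub> f c"
      using le_iff_of_images[of a c "f a" "f c"] le_iff_of_images[of b c "f b" "f c"] ab f Dc
      by (simp_all add: subset_iff)
    then show "\<exists>z\<in>f ` D. u \<sqsubseteq>\<^bsub>Q\<^esub> z \<and> v \<sqsubseteq>\<^bsub>Q\<^esub> z" using ab c(1) by blast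
  qed
  have mem: "d \<in> \<psi> B \<longleftrightarrow> f d \<in> B" if "d \<in> D" "scott_closed Q B" for d B
    using mem_psi_iff[of d "f d" B] f[OF that(1)] that Dc by blast
  have s: "\<Squnion>\<^bsub>P\<^esub>D \<in> carrier P" and e: "\<Squnion>\<^bsub>Q\<^esub>(f ` D) \<in> carrier Q"
    using P.sup_in_carrier[OF D] Q.sup_in_carrier[OF fD] by auto
  note cls = P.scott_closed_down_set[OF s] and cle = Q.scott_closed_down_set[OF e]
  show "\<phi> (down P (\<Squnion>\<^bsub>P\<^esub>D)) = down Q (\<Squnion>\<^bsub>Q\<^esub>(f ` D))"
  proof
    have "f d \<in> down Q (\<Squnion>\<^bsub>Q\<^esub>(f ` D))" if "d \<in> D" for d
      using that f(1) Q.directed_sup_upper[OF fD] by (simp add: down_def)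
    then have "D \<subseteq> \<psi> (down Q (\<Squnion>\<^bsub>Q\<^esub>(f ` D)))" using mem[OF _ cle] by blast
    then have "\<Squnion>\<^bsub>P\<^esub>D \<in> \<psi> (down Q (\<Squnion>\<^bsub>Q\<^esub>(f ` D)))"
      by (rule P.scott_closed_sup[OF psi_closed[OF cle] D])
    then show "\<phi> (down P (\<Squnion>\<^bsub>P\<^esub>D)) \<subseteq> down Q (\<Squnion>\<^bsub>Q\<^esub>(f ` D))"
      using phi_subset_iff[OF cls cle] P.down_subset_iff_mem[OF s psi_closed[OF cle]] by blast
    have "d \<in> down P (\<Squnion>\<^bsub>P\<^esub>D)" if "d \<in> D" for d
      using that Dc P.directed_sup_upper[OF D] by (auto simp: down_def)
    then have "f ` D \<subseteq> \<phi> (down P (\<Squnion>\<^bsub>P\<^esub>D))"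
      using mem[OF _ phi_closed[OF cls]] psi_phi[OF cls] by blast
    then have "\<Squnion>\<^bsub>Q\<^esub>(f ` D) \<in> \<phi> (down P (\<Squnion>\<^bsub>P\<^esub>D))"
      by (rule Q.scott_closed_sup[OF phi_closed[OF cls] fD])
    then show "down Q (\<Squnion>\<^bsub>Q\<^esub>(f ` D)) \<subseteq> \<phi> (down P (\<Squnion>\<^bsub>P\<^esub>D))"
      using Q.down_subset_iff_mem[OF e phi_closed[OF cls]] by blast
  qed
qed

text \<open>The map \<open>f\<close> with \<open>\<phi> (\<down>x) = \<down>(f x)\<close> is an order embedding. Its range is closed under directed
  suprema, and bounded sobriety makes it a lower set: for \<open>y \<sqsubseteq> f x\<close>, the irreducible closed set
  \<open>\<psi> (\<down>y)\<close> is bounded by \<open>x\<close>, hence principal. So the range is a Scott closed set, and it is all of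
  \<open>Q\<close> because its image under \<open>\<psi>\<close> contains every element of \<open>P\<close>.\<close>

lemma order_isomorphic_if_images_principal:
  assumes sober: "bounded_sober_space (scott_space P)"
    and principal: "\<And>x. x \<in> carrier P \<Longrightarrow> \<exists>y\<in>carrier Q. \<phi> (down P x) = down Q y"
  shows "order_isomorphic P Q"
proof -
  interpret flip: closed_lattice_iso Q P \<psi> \<phi> by (rule flipped)
  obtain f where f: "\<And>x. x \<in> carrier P \<Longrightarrow> f x \<in> carrier Q"
      "\<And>x. x \<in> carrier P \<Longrightarrow> \<phi> (down P x) = down Q (f x)"
    using principal by metis
  have emb: "f x \<sqsubseteq>\<^bsub>Q\<^esub> f x' \<longleftrightarrow> x \<sqsubseteq>\<^bsub>P\<^esub> x'" if "x \<in> carrier P" "x' \<in> carrier P" for x x'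
    using le_iff_of_images[OF that f(1)[OF that(1)] f(1)[OF that(2)]] f(2) that by blast
  have "scott_closed Q (f ` carrier P)"
  proof (rule Q.scott_closedI)
    show "f ` carrier P \<subseteq> carrier Q" using f(1) by blast
  next
    fix y w assume "w \<in> f ` carrier P" and y: "y \<in> carrier Q" "y \<sqsubseteq>\<^bsub>Q\<^esub> w"
    then obtain x where x: "x \<in> carrier P" "w = f x" by blast
    note cly = Q.scott_closed_down_set[OF y(1)] and clx = P.scott_closed_down_set[OF x(1)]
    have "down Q y \<subseteq> \<phi> (down P x)"
      using Q.down_subset_iff[OF y(1) f(1)[OF x(1)]] f(2)[OF x(1)] x y by simp
    then have "\<psi> (down Q y) \<subseteq> down P x"
      using flip.phi_subset_iff[OF cly clx] by blast
    moreover have "\<psi> (down Q y) \<noteq> {}" using flip.phi_nonempty[OF cly] Q.in_down_self[OF y(1)] by blast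
    ultimately obtain x' where x': "x' \<in> carrier P" "\<psi> (down Q y) = down P x'"
      using P.bounded_sober_irreducible_eq_down[OF sober psi_closed[OF cly]
        flip.irreducible_phi[OF cly Q.irreducible_down[OF y(1)]] _ x(1)] by blast
    then have "down Q y = down Q (f x')" using phi_psi[OF cly] f(2)[OF x'(1)] by simp
    then have "y = f x'" using Q.down_inject[OF y(1) f(1)[OF x'(1)]] by blast
    then show "y \<in> f ` carrier P" using x'(1) by blast
  next
    fix E assume E: "directed Q E" "E \<subseteq> f ` carrier P"
    define D where "D = {x \<in> carrier P. f x \<in> E}"
    have fD: "f ` D = E" using E(2) by (auto simp: D_def)
    have D: "directed P D"
      unfolding directed_def
    proof (intro conjI ballI)
      show "D \<subseteq> carrier P" by (auto simp: D_def)
      show "D \<noteq> {}" using fD E(1) by (auto simp: directed_def)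
      fix a b assume ab: "a \<in> D" "b \<in> D"
      then obtain w where w: "w \<in> E" "f a \<sqsubseteq>\<^bsub>Q\<^esub> w" "f b \<sqsubseteq>\<^bsub>Q\<^esub> w"
        using E(1) unfolding directed_def D_def by blast
      then obtain c where c: "c \<in> D" "w = f c" using fD by blast
      then show "\<exists>z\<in>D. a \<sqsubseteq>\<^bsub>P\<^esub> z \<and> b \<sqsubseteq>\<^bsub>P\<^esub> z"
        using w ab emb by (auto simp: D_def intro!: bexI[of _ c])
    qed
    have s: "\<Squnion>\<^bsub>P\<^esub>D \<in> carrier P" by (rule P.sup_in_carrier[OF D])
    have "\<phi> (down P (\<Squnion>\<^bsub>P\<^esub>D)) = down Q (\<Squnion>\<^bsub>Q\<^esub>(f ` D))"
      by (rule image_of_directed_sup(2)[OF D]) (use f in \<open>auto simp: D_def\<close>)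
    then have "down Q (f (\<Squnion>\<^bsub>P\<^esub>D)) = down Q (\<Squnion>\<^bsub>Q\<^esub>E)" using f(2)[OF s] fD by simp
    then have "\<Squnion>\<^bsub>Q\<^esub>E = f (\<Squnion>\<^bsub>P\<^esub>D)"
      using Q.down_inject[OF f(1)[OF s] Q.sup_in_carrier[OF E(1)]] by simp
    then show "\<Squnion>\<^bsub>Q\<^esub>E \<in> f ` carrier P" using s by blast
  qed
  note range = this
  have "x \<in> \<psi> (f ` carrier P)" if "x \<in> carrier P" for x
    using mem_psi_iff[OF that f(1)[OF that] f(2)[OF that] range] that by blast
  then have "\<psi> (carrier Q) \<subseteq> \<psi> (f ` carrier P)"
    using P.scott_closed_subset[OF psi_closed[OF Q.scott_closed_carrier]] by blast
  then have "carrier Q \<subseteq> f ` carrier P"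
    using flip.phi_subset_phi_iff[OF Q.scott_closed_carrier range] by blast
  then have "f ` carrier P = carrier Q" using f(1) by blast
  moreover have "inj_on f (carrier P)"
    using emb P.le_antisym P.le_refl by (metis inj_onI)
  ultimately have "bij_betw f (carrier P) (carrier Q)" by (simp add: bij_betw_def)
  moreover have "order_emb P Q f"
    using emb P.weak_partial_order_axioms Q.weak_partial_order_axioms
    by (simp add: order_emb_def)
  ultimately show ?thesis unfolding order_isomorphic_def by blast
qed

end

lemma (in dcpo) join_C_sigma:
  assumes "scott_closed P A" "scott_closed P B"
  shows "A \<squnion>\<^bsub>C_sigma P\<^esub> B = A \<union> B"
proof -
  interpret C: lattice "C_sigma P" by (rule lattice_C_sigma)
  have "is_lub (C_sigma P) (A \<union> B) {A, B}"
    using assms scott_closed_Un[OF assms]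
    by (simp add: C_sigma_def least_def Upper_def)
  then show ?thesis
    unfolding join_def sup_def by (metis C.least_unique someI)
qed

lemma closed_lattice_iso_of_lattice_isomorphic:
  assumes P: "dcpo P" and Q: "dcpo Q" and iso: "lattice_isomorphic (C_sigma P) (C_sigma Q)"
  shows "\<exists>\<phi> \<psi>. closed_lattice_iso P Q \<phi> \<psi>"
proof -
  interpret P: dcpo P by fact
  interpret Q: dcpo Q by fact
  obtain \<phi> where bij: "bij_betw \<phi> {A. scott_closed P A} {B. scott_closed Q B}"
    and join: "join_pres (C_sigma P) (C_sigma Q) \<phi>"
    using iso unfolding lattice_isomorphic_def by (auto simp: C_sigma_def)
  define \<psi> where "\<psi> = inv_into {A. scott_closed P A} \<phi>"
  have closed: "scott_closed Q (\<phi> A)" if "scott_closed P A" for A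
    using bij that by (auto simp: bij_betw_def)
  have \<psi>: "scott_closed P (\<psi> B)" "\<phi> (\<psi> B) = B" if "scott_closed Q B" for B
    using bij that inv_into_into[of B \<phi> "{A. scott_closed P A}"]
      f_inv_into_f[of B \<phi> "{A. scott_closed P A}"]
    by (auto simp: bij_betw_def \<psi>_def)
  have Un: "\<phi> (A \<union> A') = \<phi> A \<union> \<phi> A'" if "scott_closed P A" "scott_closed P A'" for A A'
  proof -
    have "A \<in> carrier (C_sigma P)" "A' \<in> carrier (C_sigma P)"
      using that by (simp_all add: C_sigma_def)
    then have "\<phi> (A \<squnion>\<^bsub>C_sigma P\<^esub> A') = \<phi> A \<squnion>\<^bsub>C_sigma Q\<^esub> \<phi> A'"
      using join unfolding join_pres_def by blast
    then show ?thesis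
      using P.join_C_sigma[OF that] Q.join_C_sigma[OF closed closed, OF that] by simp
  qed
  have inj: "A = A'" if "scott_closed P A" "scott_closed P A'" "\<phi> A = \<phi> A'" for A A'
    using bij that by (auto simp: bij_betw_def inj_on_def)
  have "closed_lattice_iso P Q \<phi> \<psi>"
  proof unfold_locales
    show "\<psi> (\<phi> A) = A" if "scott_closed P A" for A
      using that inj \<psi> closed by blast
    show "\<phi> A \<subseteq> \<phi> A'" if "scott_closed P A" "scott_closed P A'" "A \<subseteq> A'" for A A'
      using that Un[OF that(1,2)] by (metis Un_absorb1 Un_upper1)
    show "\<psi> B \<subseteq> \<psi> B'" if B: "scott_closed Q B" "scott_closed Q B'" "B \<subseteq> B'" for B B'
    proof -
      have "\<phi> (\<psi> B \<union> \<psi> B') = \<phi> (\<psi> B')"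
        using Un[OF \<psi>(1)[OF B(1)] \<psi>(1)[OF B(2)]] \<psi>(2) B by auto
      then have "\<psi> B \<union> \<psi> B' = \<psi> B'"
        using inj P.scott_closed_Un \<psi>(1) B by blast
      then show ?thesis by blast
    qed
  qed (use closed \<psi> in auto)
  then show ?thesis by blast
qed

section \<open>Bounded-sober dcpos generated by quasicontinuous elements\<close>

theorem theorem3p9:
  fixes P :: "'a gorder"
  assumes "dcpo P"
    and "bounded_sober_space (scott_space P)"
    and "\<forall>x\<in>carrier P. \<exists>D. directed P D \<and> (\<forall>d\<in>D. quasicontinuous_element P d) \<and>
           is_lub P x D"
  shows "SCL_faithful TYPE('b) P"
  unfolding SCL_faithful_def
proof (intro conjI allI impI)
  show "dcpo P" by fact
  fix Q :: "'b gorder"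
  assume "dcpo Q" and "lattice_isomorphic (C_sigma P) (C_sigma Q)"
  then obtain \<phi> \<psi> where "closed_lattice_iso P Q \<phi> \<psi>"
    using closed_lattice_iso_of_lattice_isomorphic[OF \<open>dcpo P\<close>] by blast
  then interpret closed_lattice_iso P Q \<phi> \<psi> .
  show "order_isomorphic P Q"
  proof (rule order_isomorphic_if_images_principal)
    show "bounded_sober_space (scott_space P)" by fact
    fix x assume "x \<in> carrier P"
    then obtain D where D: "directed P D" "\<And>d. d \<in> D \<Longrightarrow> quasicontinuous_element P d"
      and x: "is_lub P x D"
      using assms(3) by blast
    obtain f where f: "\<And>d. d \<in> D \<Longrightarrow> f d \<in> carrier Q"
        "\<And>d. d \<in> D \<Longrightarrow> \<phi> (down P d) = down Q (f d)"
      using quasicontinuous_element_image[OF D(2)] by metis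
    show "\<exists>y\<in>carrier Q. \<phi> (down P x) = down Q y"
      using image_of_directed_sup[OF D(1) f] Q.sup_in_carrier P.sup_eqI[OF x] by metis
  qed
qed

end
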